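(* Let $k\ge 2$ and let $w,g_1,\dots,g_k$ be indeterminates; work in the field of rational functions $\mathbb{Q}(w,g_1,\dots,g_k)$. For $m\ge 1$ let $\mathbf{M}_m$ be the $m\times m$ matrix with entries $$(\mathbf{M}_m)_{i,i}=1,\qquad (\mathbf{M}_m)_{i,i+1}=-g_i w\ (1\le i\le m-1),\qquad (\mathbf{M}_m)_{i,j}=-g_i \text{ for all other } j\ne i,$$ let $\mathbf{e}_m=[1,1,\dots,1]$ (a row vector of length $m$), $\mathbf{y}_m=[g_1,\dots,g_m]^T$ and $\mathbf{z}_m=[g_1,\dots,g_{m-1},w g_m]^T$, and define $$\mathcal{G}_m=\mathbf{e}_m\mathbf{M}_m^{-1}\mathbf{y}_m,\qquad \mathcal{H}_m=\mathbf{e}_m\mathbf{M}_m^{-1}\mathbf{z}_m .$$ Then $\mathcal{G}_1=g_1$, $\mathcal{H}_1=wg_1$, and $$\mathcal{G}_{k}=\mathcal{G}_{k-1}+\frac{g_k(1+\mathcal{G}_{k-1})(1+\mathcal{H}_{k-1})}{1-g_k\mathcal{H}_{k-1}},\qquad \mathcal{H}_{k}=\mathcal{G}_{k-1}+\frac{g_k(w+\mathcal{G}_{k-1})(1+\mathcal{H}_{k-1})}{1-g_k\mathcal{H}_{k-1}}.$$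
   Context: In the paper, $\mathcal{G}_k$ is the generating function (in terms of the generating functions $g_i$ of the individual integers $i$, with $w$ marking increasing successions) of sequences over $\{1,\dots,k\}$, and $\mathcal{H}_k$ is an auxiliary function; here both are defined directly by the matrix formulas in the claim. *)

theory Defs
  imports
    Complex_Main
    "HOL-Library.Poly_Mapping"
    "HOL-Computational_Algebra.Fraction_Field"
    "Jordan_Normal_Form.Gauss_Jordan_Elimination"
begin

(* A monomial is a finitely supported exponent map nat \<Rightarrow>\<^sub>0 nat, so (nat \<Rightarrow>\<^sub>0 nat) \<Rightarrow>\<^sub>0 rat is the
   polynomial ring over Q in the indeterminates X_0, X_1, X_2, ..., and ratfun is its field of
   fractions. With w = X_0 and g_i = X_i for i \<ge> 1, the field Q(w, g_1, ..., g_k) is, for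
   each k, the subfield of ratfun generated by X_0, ..., X_k. *)
type_synonym ratfun = "((nat \<Rightarrow>\<^sub>0 nat) \<Rightarrow>\<^sub>0 rat) fract"

definition indet :: "nat \<Rightarrow> ratfun" where
  "indet i = Fraction_Field.Fract (Poly_Mapping.single (Poly_Mapping.single i 1) 1) 1"

definition w_var :: ratfun where
  "w_var = indet 0"

(* Only meaningful for i \<ge> 1: at i = 0 it would coincide with w_var. *)
definition g_var :: "nat \<Rightarrow> ratfun" where
  "g_var i = indet i"

(* Positions in mat and vec are counted from 0, so position i corresponds to the index i + 1. *)
definition M_mat :: "nat \<Rightarrow> ratfun mat" where
  "M_mat m = mat m m (\<lambda>(i, j).
     if j = i then 1
     else if j = i + 1 then - (g_var (i + 1) * w_var)
     else - g_var (i + 1))"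

definition e_vec :: "nat \<Rightarrow> ratfun vec" where
  "e_vec m = vec m (\<lambda>i. 1)"

definition y_vec :: "nat \<Rightarrow> ratfun vec" where
  "y_vec m = vec m (\<lambda>i. g_var (i + 1))"

definition z_vec :: "nat \<Rightarrow> ratfun vec" where
  "z_vec m = vec m (\<lambda>i. if i + 1 = m then w_var * g_var m else g_var (i + 1))"

(* mat_inverse A is Some of the two-sided inverse if the square matrix A is invertible, and None
   otherwise, in which case mat_inv A is an unspecified value. *)
definition mat_inv :: "ratfun mat \<Rightarrow> ratfun mat" where
  "mat_inv A = the (mat_inverse A)"

definition G_fun :: "nat \<Rightarrow> ratfun" where
  "G_fun m = e_vec m \<bullet> (mat_inv (M_mat m) *\<^sub>v y_vec m)"

definition H_fun :: "nat \<Rightarrow> ratfun" where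
  "H_fun m = e_vec m \<bullet> (mat_inv (M_mat m) *\<^sub>v z_vec m)"

end

theory Submission
  imports Defs "Jordan_Normal_Form.Determinant"
begin

text \<open>
  Bordering: \<open>M_mat (Suc n)\<close> arises from \<open>M_mat n\<close> by appending the column \<open>- z_vec n\<close>, the row
  with all entries \<open>- g_var (Suc n)\<close> and the diagonal entry 1. If \<open>M_mat n\<close> maps \<open>a\<close> to
  \<open>y_vec n\<close> and \<open>b\<close> to \<open>z_vec n\<close>, then a solution for \<open>Suc n\<close> has the form \<open>(a + t b, t)\<close>, where the
  last equation determines \<open>t\<close> with the coefficient \<open>1 - g_var (Suc n) * H_fun n\<close>; if this
  coefficient vanished, \<open>(b, 1)\<close> would lie in the kernel of \<open>M_mat (Suc n)\<close>. The matrices are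
  invertible because the determinant is a polynomial with constant term 1: setting all
  indeterminates to 0 turns them into the identity matrix.
\<close>

text \<open>Exponents are natural numbers, so two monomials multiply to the trivial one only if both
  are trivial. This makes taking the constant coefficient a ring homomorphism, which therefore
  commutes with \<open>det\<close>.\<close>

lemma lookup_mult_zero:
  fixes p q :: "(nat \<Rightarrow>\<^sub>0 nat) \<Rightarrow>\<^sub>0 'a::semiring_0"
  shows "Poly_Mapping.lookup (p * q) 0 = Poly_Mapping.lookup p 0 * Poly_Mapping.lookup q 0"
proof -
  have sum_zero: "(0 = l + r) = (r = 0 \<and> l = 0)" for l r :: "nat \<Rightarrow>\<^sub>0 nat"
    by (auto simp: poly_mapping_eq_iff lookup_add fun_eq_iff)
  have "Poly_Mapping.lookup p l * (\<Sum>r. Poly_Mapping.lookup q r when 0 = l + r) 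
      = (Poly_Mapping.lookup p l * Poly_Mapping.lookup q 0 when l = 0)" for l
    by (cases "l = 0") (simp_all add: sum_zero)
  then show ?thesis
    by (simp add: lookup_mult)
qed

interpretation const_coeff: comm_ring_hom
  "\<lambda>p :: (nat \<Rightarrow>\<^sub>0 nat) \<Rightarrow>\<^sub>0 'a::comm_ring_1. Poly_Mapping.lookup p 0"
  by standard (simp_all add: lookup_mult_zero lookup_add)

interpretation Fract_one: comm_ring_hom "\<lambda>p :: 'a::idom. Fraction_Field.Fract p 1"
  by standard (simp_all add: fract_collapse)

text \<open>Generic in the ring, so that the same matrix can be formed over the polynomials, where
  constant coefficients make sense, and over \<open>ratfun\<close>.\<close>

definition M_entry :: "(nat \<Rightarrow> 'a::comm_ring_1) \<Rightarrow> nat \<Rightarrow> nat \<Rightarrow> 'a" where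
  "M_entry X i j = (if j = i then 1 else if j = Suc i then - (X (Suc i) * X 0) else - X (Suc i))"

lemma M_mat_eq: "M_mat m = mat m m (\<lambda>(i, j). M_entry indet i j)"
  by (auto simp: M_mat_def M_entry_def g_var_def w_var_def)

lemma M_mat_carrier [simp]: "M_mat m \<in> carrier_mat m m"
  by (simp add: M_mat_def)

lemma det_M_mat_nonzero: "det (M_mat m) \<noteq> 0"
proof -
  define X :: "nat \<Rightarrow> (nat \<Rightarrow>\<^sub>0 nat) \<Rightarrow>\<^sub>0 rat"
    where "X i = Poly_Mapping.single (Poly_Mapping.single i 1) 1" for i
  define P where "P = mat m m (\<lambda>(i, j). M_entry X i j)"
  have "map_mat (\<lambda>p. Fraction_Field.Fract p 1) P = M_mat m"
    by (rule eq_matI) (auto simp: M_mat_eq P_def M_entry_def indet_def X_def fract_collapse)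
  then have det_M: "det (M_mat m) = Fraction_Field.Fract (det P) 1"
    using Fract_one.hom_det[of P] by simp
  have X0: "Poly_Mapping.lookup (X i) 0 = 0" for i
  proof -
    have "Poly_Mapping.single i 1 \<noteq> (0 :: nat \<Rightarrow>\<^sub>0 nat)"
      by (metis lookup_single_eq lookup_zero one_neq_zero)
    then show ?thesis
      by (simp add: X_def lookup_single)
  qed
  \<comment> \<open>Each off-diagonal entry has a factor \<open>X (Suc i)\<close>, whose constant
    coefficient is 0.\<close>
  have "map_mat (\<lambda>p. Poly_Mapping.lookup p 0) P = 1\<^sub>m m"
    by (rule eq_matI) (auto simp: P_def M_entry_def X0 lookup_mult_zero)
  then have "Poly_Mapping.lookup (det P) 0 = 1"
    using const_coeff.hom_det[of P] by simp
  then have "det P \<noteq> 0"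
    by auto
  then show ?thesis
    using eq_fract(1)[of 1 1 "det P" 0] by (simp add: det_M fract_collapse)
qed

lemma mat_inv_M_mat:
  "mat_inv (M_mat m) \<in> carrier_mat m m"
  "M_mat m * mat_inv (M_mat m) = 1\<^sub>m m"
  "mat_inv (M_mat m) * M_mat m = 1\<^sub>m m"
proof -
  have "M_mat m \<in> Units (ring_mat TYPE(ratfun) m ())"
    by (rule det_non_zero_imp_unit[OF M_mat_carrier det_M_mat_nonzero])
  \<comment> \<open>The result \<open>None\<close> would contradict membership in
    \<open>Units\<close>, so \<open>the\<close> in \<open>mat_inv\<close> returns a genuine
    inverse.\<close>
  then obtain B where "mat_inverse (M_mat m) = Some B"
    using mat_inverse(1)[OF M_mat_carrier, of m "()"] by (cases "mat_inverse (M_mat m)") auto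
  then show "mat_inv (M_mat m) \<in> carrier_mat m m"
    "M_mat m * mat_inv (M_mat m) = 1\<^sub>m m"
    "mat_inv (M_mat m) * M_mat m = 1\<^sub>m m"
    using mat_inverse(2)[OF M_mat_carrier] by (auto simp: mat_inv_def)
qed

lemma invertible_M_mat: "invertible_mat (M_mat m)"
proof -
  have "dim_row (mat_inv (M_mat m)) = m" "dim_row (M_mat m) = m" "dim_col (M_mat m) = m"
    using mat_inv_M_mat(1)[of m] by (auto simp: M_mat_def)
  then show ?thesis
    unfolding invertible_mat_def inverts_mat_def using mat_inv_M_mat[of m] by auto
qed

text \<open>Functions on \<open>nat\<close> instead of vectors let a solution of size
  \<open>n\<close> be extended to size \<open>Suc n\<close> by splitting off the last
  summand.\<close>

definition solves :: "nat \<Rightarrow> (nat \<Rightarrow> ratfun) \<Rightarrow> (nat \<Rightarrow> ratfun) \<Rightarrow> bool" where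
  "solves m x v \<longleftrightarrow> (\<forall>i<m. (\<Sum>j<m. M_entry indet i j * x j) = v i)"

lemma solves_iff: "solves m x v \<longleftrightarrow> M_mat m *\<^sub>v vec m x = vec m v"
  by (auto simp: solves_def M_mat_eq vec_eq_iff scalar_prod_def atLeast0LessThan)

lemma solves_iff_mat_inv: "solves m x v \<longleftrightarrow> vec m x = mat_inv (M_mat m) *\<^sub>v vec m v"
proof
  assume "solves m x v"
  then have "mat_inv (M_mat m) *\<^sub>v vec m v = (mat_inv (M_mat m) * M_mat m) *\<^sub>v vec m x"
    by (simp only: solves_iff assoc_mult_mat_vec[OF mat_inv_M_mat(1) M_mat_carrier vec_carrier])
  then show "vec m x = mat_inv (M_mat m) *\<^sub>v vec m v"
    by (simp add: mat_inv_M_mat)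
next
  assume "vec m x = mat_inv (M_mat m) *\<^sub>v vec m v"
  then have "M_mat m *\<^sub>v vec m x = (M_mat m * mat_inv (M_mat m)) *\<^sub>v vec m v"
    by (simp only: assoc_mult_mat_vec[OF M_mat_carrier mat_inv_M_mat(1) vec_carrier])
  then show "solves m x v"
    by (simp add: solves_iff mat_inv_M_mat)
qed

lemma solves_exists: "\<exists>x. solves m x v"
proof
  have "mat_inv (M_mat m) *\<^sub>v vec m v \<in> carrier_vec m"
    by (rule mult_mat_vec_carrier[OF mat_inv_M_mat(1)]) simp
  then show "solves m (\<lambda>i. (mat_inv (M_mat m) *\<^sub>v vec m v) $ i) v"
    unfolding solves_iff_mat_inv by (intro eq_vecI) (simp_all only: index_vec dim_vec carrier_vecD)
qed

lemma solves_zeroD: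
  assumes "solves m x (\<lambda>_. 0)" and "i < m"
  shows "x i = 0"
proof -
  have "solves m (\<lambda>_. 0) (\<lambda>_. 0)"
    by (simp add: solves_def)
  with assms(1) have "vec m x = vec m (\<lambda>_. 0)"
    by (simp add: solves_iff_mat_inv)
  with assms(2) show ?thesis
    by (simp add: vec_eq_iff)
qed

definition z_entry :: "nat \<Rightarrow> nat \<Rightarrow> ratfun" where
  "z_entry m i = (if Suc i = m then w_var * g_var m else g_var (Suc i))"

lemma G_fun_eq:
  assumes "solves m x (\<lambda>i. g_var (Suc i))"
  shows "G_fun m = (\<Sum>j<m. x j)"
proof -
  have "mat_inv (M_mat m) *\<^sub>v y_vec m = vec m x"
    using assms by (simp add: y_vec_def solves_iff_mat_inv)
  then show ?thesis
    by (simp add: G_fun_def e_vec_def scalar_prod_def atLeast0LessThan)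
qed

lemma H_fun_eq:
  assumes "solves m x (z_entry m)"
  shows "H_fun m = (\<Sum>j<m. x j)"
proof -
  have "z_vec m = vec m (z_entry m)"
    by (auto simp: z_vec_def z_entry_def)
  then have "mat_inv (M_mat m) *\<^sub>v z_vec m = vec m x"
    using assms by (simp add: solves_iff_mat_inv)
  then show ?thesis
    by (simp add: H_fun_def e_vec_def scalar_prod_def atLeast0LessThan)
qed

text \<open>In column \<open>n\<close> the superdiagonal position is row \<open>n - 1\<close>,
  exactly where \<open>z_entry n\<close> carries the factor \<open>w_var\<close>.\<close>

lemma M_entry_last_col: "i < n \<Longrightarrow> M_entry indet i n = - z_entry n i"
  by (auto simp: M_entry_def z_entry_def g_var_def w_var_def)

lemma M_entry_last_row: "j < n \<Longrightarrow> M_entry indet n j = - g_var (Suc n)"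
  by (auto simp: M_entry_def g_var_def)

lemma M_entry_diag: "M_entry X i i = 1"
  by (simp add: M_entry_def)

text \<open>In the first \<open>n\<close> rows the part \<open>t * b\<close> cancels the
  contribution of the new column. The last assumption is the last row, written without division so
  that it can also be used when the coefficient of \<open>t\<close> is 0.\<close>

lemma solves_Suc:
  assumes "solves n a u" and "solves n b (z_entry n)"
    and "\<And>i. i < n \<Longrightarrow> v i = u i"
    and "t * (1 - g_var (Suc n) * (\<Sum>j<n. b j)) = v n + g_var (Suc n) * (\<Sum>j<n. a j)"
  shows "solves (Suc n) (\<lambda>j. if j < n then a j + t * b j else t) v"
  unfolding solves_def
proof (intro allI impI)
  let ?x = "\<lambda>j. if j < n then a j + t * b j else t"
  fix i assume "i < Suc n"
  then consider "i < n" | "i = n" by linarith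
  then show "(\<Sum>j<Suc n. M_entry indet i j * ?x j) = v i"
  proof cases
    case 1
    have "(\<Sum>j<n. M_entry indet i j * ?x j)
        = (\<Sum>j<n. M_entry indet i j * a j) + t * (\<Sum>j<n. M_entry indet i j * b j)"
      by (simp add: sum_distrib_left algebra_simps flip: sum.distrib)
    also have "\<dots> = v i + t * z_entry n i"
      using assms 1 by (simp add: solves_def)
    finally show ?thesis
      using 1 by (simp add: M_entry_last_col)
  next
    case 2
    have "(\<Sum>j<n. M_entry indet n j * ?x j) = (\<Sum>j<n. - g_var (Suc n) * (a j + t * b j))"
      by (intro sum.cong) (simp_all add: M_entry_last_row)
    also have "\<dots> = - g_var (Suc n) * ((\<Sum>j<n. a j) + t * (\<Sum>j<n. b j))"
      by (simp only: sum_distrib_left[symmetric] sum.distrib)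
    finally have "(\<Sum>j<Suc n. M_entry indet n j * ?x j)
        = - g_var (Suc n) * ((\<Sum>j<n. a j) + t * (\<Sum>j<n. b j)) + t"
      by (simp add: M_entry_diag)
    also have "\<dots> = v n"
      using assms(4) by (simp add: algebra_simps)
    finally show ?thesis
      by (simp only: 2)
  qed
qed

lemma denominator_nonzero: "1 - g_var (Suc n) * H_fun n \<noteq> 0"
proof
  assume zero: "1 - g_var (Suc n) * H_fun n = 0"
  obtain b where b: "solves n b (z_entry n)"
    using solves_exists by blast
  have "solves n (\<lambda>_. 0) (\<lambda>_. 0)"
    by (simp add: solves_def)
  \<comment> \<open>With \<open>a = 0\<close> and \<open>v = 0\<close> the last row reads 0 = 0, so
    \<open>t = 1\<close> is allowed and yields a kernel vector with last entry 1.\<close>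
  from solves_Suc[OF this b, of "\<lambda>_. 0" 1]
  have "solves (Suc n) (\<lambda>j. if j < n then 0 + 1 * b j else 1) (\<lambda>_. 0)"
    using zero H_fun_eq[OF b] by simp
  from solves_zeroD[OF this, of n] show False
    by simp
qed

text \<open>Both right-hand sides of size \<open>Suc n\<close> extend \<open>y_vec n\<close> and
  differ only in the factor \<open>c\<close> of the last entry: 1 for \<open>y_vec\<close>,
  \<open>w_var\<close> for \<open>z_vec\<close>. Hence both recurrences start with
  \<open>G_fun n\<close>.\<close>

lemma border_step:
  assumes "\<And>i. i < n \<Longrightarrow> v i = g_var (Suc i)" and "v n = c * g_var (Suc n)"
  obtains x where "solves (Suc n) x v"
    "(\<Sum>j<Suc n. x j) = G_fun n
      + g_var (Suc n) * (c + G_fun n) * (1 + H_fun n) / (1 - g_var (Suc n) * H_fun n)"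
proof -
  obtain a b where a: "solves n a (\<lambda>i. g_var (Suc i))" and b: "solves n b (z_entry n)"
    using solves_exists by meson
  \<comment> \<open>The last row solved for \<open>t\<close>, with
    \<open>v n = c * g_var (Suc n)\<close>.\<close>
  define t where "t = g_var (Suc n) * (c + G_fun n) / (1 - g_var (Suc n) * H_fun n)"
  let ?x = "\<lambda>j. if j < n then a j + t * b j else t"
  have "t * (1 - g_var (Suc n) * H_fun n) = v n + g_var (Suc n) * G_fun n"
    using denominator_nonzero[of n] assms(2) unfolding t_def by (simp add: distrib_left)
  then have "solves (Suc n) ?x v"
    using assms(1) by (intro solves_Suc[OF a b]) (simp_all flip: G_fun_eq[OF a] H_fun_eq[OF b])
  moreover have "(\<Sum>j<Suc n. ?x j) = G_fun n + t * (1 + H_fun n)"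
    by (simp add: G_fun_eq[OF a] H_fun_eq[OF b] sum.distrib sum_distrib_left algebra_simps)
  moreover have "G_fun n + t * (1 + H_fun n) = G_fun n
      + g_var (Suc n) * (c + G_fun n) * (1 + H_fun n) / (1 - g_var (Suc n) * H_fun n)"
    by (simp add: t_def)
  ultimately show thesis
    by (intro that) (simp_all only:)
qed

lemma G_fun_Suc: "G_fun (Suc n) = G_fun n
    + g_var (Suc n) * (1 + G_fun n) * (1 + H_fun n) / (1 - g_var (Suc n) * H_fun n)"
  by (rule border_step[of n "\<lambda>i. g_var (Suc i)" 1]) (simp_all add: G_fun_eq)

lemma H_fun_Suc: "H_fun (Suc n) = G_fun n
    + g_var (Suc n) * (w_var + G_fun n) * (1 + H_fun n) / (1 - g_var (Suc n) * H_fun n)"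
  by (rule border_step[of n "z_entry (Suc n)" w_var]) (simp_all add: H_fun_eq z_entry_def)

lemma G_fun_0: "G_fun 0 = 0" and H_fun_0: "H_fun 0 = 0"
  using G_fun_eq[of 0] H_fun_eq[of 0] by (simp_all add: solves_def)

theorem theorem1:
  fixes k :: nat
  assumes "k \<ge> 2"
  shows "(\<forall>m\<in>{1..k}. invertible_mat (M_mat m))
    \<and> G_fun 1 = g_var 1
    \<and> H_fun 1 = w_var * g_var 1
    \<and> 1 - g_var k * H_fun (k - 1) \<noteq> 0
    \<and> G_fun k = G_fun (k - 1)
        + g_var k * (1 + G_fun (k - 1)) * (1 + H_fun (k - 1)) / (1 - g_var k * H_fun (k - 1))
    \<and> H_fun k = G_fun (k - 1)
        + g_var k * (w_var + G_fun (k - 1)) * (1 + H_fun (k - 1)) / (1 - g_var k * H_fun (k - 1))"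
proof -
  obtain n where "k = Suc n"
    using assms by (cases k) auto
  then show ?thesis
    \<comment> \<open>The values at 1 are the recurrences at \<open>n = 0\<close>, where the empty
      matrix gives 0 for both functions.\<close>
    using invertible_M_mat denominator_nonzero[of n] G_fun_Suc[of n] H_fun_Suc[of n]
      G_fun_Suc[of 0] H_fun_Suc[of 0]
    by (simp add: G_fun_0 H_fun_0 mult.commute)
qed

end
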